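(* Fix a noise level $\sigma$ and let $D_v(n) \in \mathbb{R}^d$ denote the prediction of branch $v \in \{0,p\}$ of a denoiser under noise realization $n$. With independent draws $n, n'$ (from the same noise distribution) across the two branches, the consistency term satisfies $$\mathbb{E}_{n,n'} \lVert D_0(n) - D_p(n')\rVert^2 = \mathbb{E}_{n} \lVert D_0(n) - D_p(n)\rVert^2 + 2\,\mathrm{tr}\,\mathrm{Cov}_n\bigl(D_0(n), D_p(n)\bigr).$$ At exact view invariance, $D_0 \equiv D_p \equiv D$, the added term $2\,\mathrm{tr}\,\mathrm{Cov}_n(D_0(n),D_p(n))$ equals $2\,\mathrm{tr}\,\mathrm{Var}_n(D) > 0$: the independent-noise objective $\mathbb{E}_{n,n'} \lVert D_0(n) - D_p(n')\rVert^2$ cannot reach zero even for a perfectly invariant denoiser, and its residual gradient penalizes the legitimate dependence of a correct denoiser on its noisy input.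
   Context: A denoiser is a network that receives a noisy version of a target, formed using a noise level $\sigma$ and a random noise realization $n$, together with a conditioning observation, and outputs a prediction of the clean target. Two branches of the same denoiser are run on a pair of observations of the same physical state: branch $0$ is conditioned on the image from a nominal camera and branch $p$ on the image from a perturbed camera; $D_0(n)$ and $D_p(n)$ are their predictions, viewed as functions of the noise realization at fixed $\sigma$. The consistency term is the squared Euclidean distance between the two branches' predictions, in expectation over the noise: $\mathbb{E}_n\lVert D_0(n)-D_p(n)\rVert^2$ when both branches share one noise draw, and $\mathbb{E}_{n,n'}\lVert D_0(n)-D_p(n')\rVert^2$ (the independent-noise objective) when the branches use independent draws $n$ and $n'$. Exact view invariance means that the two branches give the same prediction for every noise realization. Predictions are taken to be square-integrable. For square-integrable $\mathbb{R}^d$-valued random vectors $X,Y$, $\mathrm{Cov}(X,Y)=\mathbb{E}[(X-\mathbb{E}X)(Y-\mathbb{E}Y)^{\top}]$ and $\mathrm{Var}(X)=\mathrm{Cov}(X,X)$, so $\mathrm{tr}\,\mathrm{Cov}(X,Y)=\mathbb{E}\langle X,Y\rangle-\langle\mathbb{E}X,\mathbb{E}Y\rangle$; the subscript $n$ means that the moments are taken over the noise realization $n$.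
   Formalization: The strict positivity of 2 tr Var_n(D), and hence of the independent-noise objective at exact view invariance, is claimed only when D is not almost surely constant in the noise; for a constant D both are zero. *)

theory Defs
  imports "HOL-Probability.Probability"
begin

definition square_integrable :: "'n measure \<Rightarrow> ('n \<Rightarrow> real ^ 'd) \<Rightarrow> bool" where
  "square_integrable M X \<longleftrightarrow>
     X \<in> borel_measurable M \<and> integrable M (\<lambda>n. (norm (X n))\<^sup>2)"

definition Expect :: "'n measure \<Rightarrow> ('n \<Rightarrow> real ^ 'd) \<Rightarrow> real ^ 'd" where
  "Expect M X = (\<integral>n. X n \<partial>M)"

definition Cov :: "'n measure \<Rightarrow> ('n \<Rightarrow> real ^ 'd) \<Rightarrow> ('n \<Rightarrow> real ^ 'd) \<Rightarrow> real ^ 'd ^ 'd" where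
  "Cov M X Y =
     (\<integral>n. (columnvector (X n - Expect M X) :: real ^ 1 ^ 'd)
           ** transpose (columnvector (Y n - Expect M Y)) \<partial>M)"

definition Var :: "'n measure \<Rightarrow> ('n \<Rightarrow> real ^ 'd) \<Rightarrow> real ^ 'd ^ 'd" where
  "Var M X = Cov M X X"

definition shared_consistency :: "'n measure \<Rightarrow> ('n \<Rightarrow> real ^ 'd) \<Rightarrow> ('n \<Rightarrow> real ^ 'd) \<Rightarrow> real" where
  "shared_consistency M X Y = (\<integral>n. (norm (X n - Y n))\<^sup>2 \<partial>M)"

text \<open>Two independent draws from the noise distribution \<open>M\<close> have joint law \<open>M \<Otimes>\<^sub>M M\<close>.\<close>

definition indep_consistency :: "'n measure \<Rightarrow> ('n \<Rightarrow> real ^ 'd) \<Rightarrow> ('n \<Rightarrow> real ^ 'd) \<Rightarrow> real" where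
  "indep_consistency M X Y = (\<integral>(n, n'). (norm (X n - Y n'))\<^sup>2 \<partial>(M \<Otimes>\<^sub>M M))"

definition ae_constant :: "'n measure \<Rightarrow> ('n \<Rightarrow> real ^ 'd) \<Rightarrow> bool" where
  "ae_constant M X \<longleftrightarrow> (\<exists>c. AE n in M. X n = c)"

definition L2_inner :: "'n measure \<Rightarrow> ('n \<Rightarrow> real ^ 'd) \<Rightarrow> ('n \<Rightarrow> real ^ 'd) \<Rightarrow> real" where
  "L2_inner M X Y = (\<integral>n. X n \<bullet> Y n \<partial>M)"

definition L2_pair_norm :: "'n measure \<Rightarrow> ('n \<Rightarrow> real ^ 'd) \<Rightarrow> ('n \<Rightarrow> real ^ 'd) \<Rightarrow> real" where
  "L2_pair_norm M X Y = sqrt (L2_inner M X X + L2_inner M Y Y)"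

text \<open>\<open>(G, H)\<close> is the gradient at \<open>(X, Y)\<close> of a functional \<open>J\<close> of the two branches' predictions:
  it represents the Frechet derivative of \<open>J\<close> for the \<open>L\<^sup>2\<close> inner product on pairs of
  square-integrable predictions. The derivative of \<open>J\<close> with respect to network parameters is
  obtained from it by the chain rule. It determines \<open>G\<close> and \<open>H\<close> up to almost-everywhere
  equality.\<close>

definition has_L2_gradient ::
  "'n measure \<Rightarrow> (('n \<Rightarrow> real ^ 'd) \<Rightarrow> ('n \<Rightarrow> real ^ 'd) \<Rightarrow> real) \<Rightarrow>
   ('n \<Rightarrow> real ^ 'd) \<Rightarrow> ('n \<Rightarrow> real ^ 'd) \<Rightarrow> ('n \<Rightarrow> real ^ 'd) \<Rightarrow> ('n \<Rightarrow> real ^ 'd) \<Rightarrow> bool" where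
  "has_L2_gradient M J X Y G H \<longleftrightarrow>
     square_integrable M G \<and> square_integrable M H \<and>
     (\<forall>e>0. \<exists>\<delta>>0. \<forall>U V.
        square_integrable M U \<longrightarrow> square_integrable M V \<longrightarrow> L2_pair_norm M U V < \<delta> \<longrightarrow>
        \<bar>J (\<lambda>n. X n + U n) (\<lambda>n. Y n + V n) - J X Y - (L2_inner M G U + L2_inner M H V)\<bar>
          \<le> e * L2_pair_norm M U V)"

text \<open>The prediction \<open>X\<close> with its dependence on the noise rescaled by \<open>t\<close>, at the same mean.\<close>

definition scale_noise_dependence ::
  "'n measure \<Rightarrow> ('n \<Rightarrow> real ^ 'd) \<Rightarrow> real \<Rightarrow> 'n \<Rightarrow> real ^ 'd" where
  "scale_noise_dependence M X t n = Expect M X + t *\<^sub>R (X n - Expect M X)"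

end

theory Submission
  imports Defs
begin

text \<open>Both objectives expand into \<open>\<bbbE>\<parallel>X\<parallel>\<^sup>2 + \<bbbE>\<parallel>Y\<parallel>\<^sup>2\<close> minus a cross term, which is
  \<open>2 \<bbbE>\<langle>X, Y\<rangle>\<close> for shared and, by Fubini, \<open>2 \<langle>\<bbbE>X, \<bbbE>Y\<rangle>\<close> for independent draws; the
  difference is twice the trace of the covariance. Both objectives are quadratic, so the remainder of their
  first-order expansion at \<open>(X, Y)\<close> in direction \<open>(U, V)\<close> is the same objective at \<open>(U, V)\<close>,
  which is at most \<open>2(\<bbbE>\<parallel>U\<parallel>\<^sup>2 + \<bbbE>\<parallel>V\<parallel>\<^sup>2)\<close>.\<close>

section \<open>Pointwise inequalities, outer products and the trace\<close>

lemma power2_norm_add: "(norm (a + b))\<^sup>2 = (norm a)\<^sup>2 + (norm b)\<^sup>2 + 2 * (a \<bullet> b)"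
  for a b :: "'a::real_inner"
  by (simp add: power2_norm_eq_inner inner_add_left inner_add_right inner_commute)

lemma power2_norm_diff: "(norm (a - b))\<^sup>2 = (norm a)\<^sup>2 + (norm b)\<^sup>2 - 2 * (a \<bullet> b)"
  for a b :: "'a::real_inner"
  by (simp add: power2_norm_eq_inner inner_diff_left inner_diff_right inner_commute)

text \<open>Nonnegativity of the squared norms of \<open>a + b\<close> and \<open>a - b\<close>
  gives the two signs. This bound supplies most of the integrable majorants below.\<close>

lemma abs_two_inner_le: "\<bar>2 * (a \<bullet> b)\<bar> \<le> (norm a)\<^sup>2 + (norm b)\<^sup>2"
  for a b :: "'a::real_inner"
  using zero_le_power2[of "norm (a + b)"] zero_le_power2[of "norm (a - b)"]
  unfolding power2_norm_add power2_norm_diff by linarith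

lemma power2_norm_diff_le: "(norm (a - b))\<^sup>2 \<le> 2 * ((norm a)\<^sup>2 + (norm b)\<^sup>2)"
  for a b :: "'a::real_inner"
  using zero_le_power2[of "norm (a + b)"]
  unfolding power2_norm_add power2_norm_diff by (simp add: algebra_simps)

text \<open>\<open>axis i (axis j 1)\<close> is the matrix unit at \<open>(i, j)\<close>. In this
  expansion, integrability of the matrix-valued integrand of \<open>Cov\<close> reduces to that of
  scalar products of coordinates.\<close>

lemma outer_product_eq_sum:
  fixes a b :: "real ^ 'd"
  shows "(columnvector a :: real ^ 1 ^ 'd) ** transpose (columnvector b)
           = (\<Sum>i\<in>UNIV. \<Sum>j\<in>UNIV. (a $ i * b $ j) *\<^sub>R axis i (axis j 1))"
proof -
  \<comment> \<open>The row test of a matrix unit does not depend on \<open>j\<close>; hoisting it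
    out of the inner sum lets the double sum collapse to a single entry.\<close>
  have "(\<Sum>j\<in>UNIV. if P then f j else 0) = (if P then \<Sum>j\<in>UNIV. f j else 0)"
    for P and f :: "'d \<Rightarrow> real"
    by simp
  then show ?thesis
    by (simp add: vec_eq_iff matrix_matrix_mult_def columnvector_def transpose_def axis_def
        if_distrib[where f = "\<lambda>x. x $ _"] if_distrib[where f = "\<lambda>x. _ * x"] cong: if_cong)
qed

lemma trace_outer_product:
  fixes a b :: "real ^ 'd"
  shows "trace ((columnvector a :: real ^ 1 ^ 'd) ** transpose (columnvector b)) = a \<bullet> b"
  by (simp add: trace_def matrix_matrix_mult_def columnvector_def transpose_def inner_vec_def)

text \<open>Bounded linear maps commute with the Bochner integral, so the trace can be moved inside
  the integral defining \<open>Cov\<close>.\<close>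

lemma bounded_linear_trace: "bounded_linear (trace :: real ^ 'd ^ 'd \<Rightarrow> real)"
  unfolding trace_def
  by (intro bounded_linear_sum bounded_linear_compose[OF bounded_linear_vec_nth]
      bounded_linear_vec_nth)

section \<open>Closure properties of square-integrable predictions\<close>

lemma square_integrable_cong:
  assumes "\<And>n. n \<in> space M \<Longrightarrow> X n = Y n"
  shows "square_integrable M X \<longleftrightarrow> square_integrable M Y"
  unfolding square_integrable_def using assms
  by (auto cong: measurable_cong Bochner_Integration.integrable_cong)

lemma square_integrable_inner:
  assumes X: "square_integrable M X" and Y: "square_integrable M Y"
  shows "integrable M (\<lambda>n. X n \<bullet> Y n)"
proof (rule Bochner_Integration.integrable_bound)
  show "integrable M (\<lambda>n. (norm (X n))\<^sup>2 + (norm (Y n))\<^sup>2)"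
    using assms by (simp add: square_integrable_def)
  show "(\<lambda>n. X n \<bullet> Y n) \<in> borel_measurable M"
    using assms by (auto simp: square_integrable_def)
  show "AE n in M. norm (X n \<bullet> Y n) \<le> norm ((norm (X n))\<^sup>2 + (norm (Y n))\<^sup>2)"
  proof (rule AE_I2)
    fix n show "norm (X n \<bullet> Y n) \<le> norm ((norm (X n))\<^sup>2 + (norm (Y n))\<^sup>2)"
      using abs_two_inner_le[of "X n" "Y n"] by simp
  qed
qed

lemma square_integrable_add:
  assumes X: "square_integrable M X" and Y: "square_integrable M Y"
  shows "square_integrable M (\<lambda>n. X n + Y n)"
  using assms square_integrable_inner[OF assms]
  by (auto simp: square_integrable_def power2_norm_add)

lemma square_integrable_scaleR:
  "square_integrable M X \<Longrightarrow> square_integrable M (\<lambda>n. c *\<^sub>R X n)"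
  by (auto simp: square_integrable_def power_mult_distrib)

lemma square_integrable_diff:
  assumes X: "square_integrable M X" and Y: "square_integrable M Y"
  shows "square_integrable M (\<lambda>n. X n - Y n)"
  using square_integrable_add[OF X square_integrable_scaleR[OF Y, of "-1"]] by simp

text \<open>Each coordinate is at most the norm in absolute value, so the sum of the two squared
  norms is an integrable majorant.\<close>

lemma square_integrable_component_mult:
  fixes X Y :: "'n \<Rightarrow> real ^ 'd"
  assumes X: "square_integrable M X" and Y: "square_integrable M Y"
  shows "integrable M (\<lambda>n. X n $ i * Y n $ j)"
proof (rule Bochner_Integration.integrable_bound)
  show "integrable M (\<lambda>n. (norm (X n))\<^sup>2 + (norm (Y n))\<^sup>2)"
    using assms by (simp add: square_integrable_def)
  have vec_nth: "(\<lambda>x :: real ^ 'd. x $ k) \<in> borel_measurable borel" for k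
    by (intro borel_measurable_continuous_onI continuous_on_component continuous_on_id)
  have "(\<lambda>n. X n $ i) \<in> borel_measurable M" "(\<lambda>n. Y n $ j) \<in> borel_measurable M"
    using assms by (auto simp: square_integrable_def intro!: measurable_compose[OF _ vec_nth])
  then show "(\<lambda>n. X n $ i * Y n $ j) \<in> borel_measurable M"
    by simp
  show "AE n in M. norm (X n $ i * Y n $ j) \<le> norm ((norm (X n))\<^sup>2 + (norm (Y n))\<^sup>2)"
  proof (rule AE_I2)
    fix n
    have "(x $ k)\<^sup>2 \<le> (norm x)\<^sup>2" for x :: "real ^ 'd" and k
      using abs_le_square_iff[of "x $ k" "norm x"] component_le_norm_cart[of x k] by simp
    from this[of "X n" i] this[of "Y n" j]
    show "norm (X n $ i * Y n $ j) \<le> norm ((norm (X n))\<^sup>2 + (norm (Y n))\<^sup>2)"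
      using abs_two_inner_le[of "X n $ i" "Y n $ j"] by simp
  qed
qed

section \<open>The bilinear form \<open>L2_inner\<close> and the norm on pairs\<close>

lemma L2_inner_self: "L2_inner M X X = (\<integral>n. (norm (X n))\<^sup>2 \<partial>M)"
  by (simp add: L2_inner_def power2_norm_eq_inner)

lemma L2_inner_commute: "L2_inner M X Y = L2_inner M Y X"
  by (simp add: L2_inner_def inner_commute)

lemma L2_inner_self_nonneg: "0 \<le> L2_inner M X X"
  by (simp add: L2_inner_self)

lemma L2_inner_add_left:
  assumes "square_integrable M X" "square_integrable M Y" "square_integrable M Z"
  shows "L2_inner M (\<lambda>n. X n + Y n) Z = L2_inner M X Z + L2_inner M Y Z"
  using assms by (simp add: L2_inner_def inner_add_left square_integrable_inner)

lemma L2_inner_add_right: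
  assumes "square_integrable M X" "square_integrable M Y" "square_integrable M Z"
  shows "L2_inner M Z (\<lambda>n. X n + Y n) = L2_inner M Z X + L2_inner M Z Y"
  using L2_inner_add_left[OF assms] by (simp add: L2_inner_commute)

lemma L2_inner_diff_left:
  assumes "square_integrable M X" "square_integrable M Y" "square_integrable M Z"
  shows "L2_inner M (\<lambda>n. X n - Y n) Z = L2_inner M X Z - L2_inner M Y Z"
  using assms by (simp add: L2_inner_def inner_diff_left square_integrable_inner)

lemma L2_inner_diff_right:
  assumes "square_integrable M X" "square_integrable M Y" "square_integrable M Z"
  shows "L2_inner M Z (\<lambda>n. X n - Y n) = L2_inner M Z X - L2_inner M Z Y"
  using L2_inner_diff_left[OF assms] by (simp add: L2_inner_commute)

lemma L2_inner_scaleR_left: "L2_inner M (\<lambda>n. c *\<^sub>R X n) Y = c * L2_inner M X Y"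
  by (simp add: L2_inner_def)

lemma L2_pair_norm_nonneg: "0 \<le> L2_pair_norm M U V"
  by (simp add: L2_pair_norm_def L2_inner_self_nonneg)

lemma L2_pair_norm_power2: "(L2_pair_norm M U V)\<^sup>2 = L2_inner M U U + L2_inner M V V"
  by (simp add: L2_pair_norm_def L2_inner_self_nonneg)

text \<open>The integrated form of \<open>abs_two_inner_le\<close>, obtained from the same two
  squares.\<close>

lemma abs_L2_inner_le:
  assumes "square_integrable M U" "square_integrable M V"
  shows "\<bar>2 * L2_inner M U V\<bar> \<le> (L2_pair_norm M U V)\<^sup>2"
  using L2_inner_self_nonneg[of M "\<lambda>n. U n + V n"] L2_inner_self_nonneg[of M "\<lambda>n. U n - V n"] assms
  by (simp add: L2_pair_norm_power2 L2_inner_add_left L2_inner_add_right L2_inner_diff_left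
      L2_inner_diff_right L2_inner_commute[of M V U] square_integrable_add square_integrable_diff)

section \<open>Gradients from quadratic remainders, and the shared-noise objective\<close>

lemma has_L2_gradientI:
  assumes G: "square_integrable M G" and H: "square_integrable M H"
    and bound: "\<And>U V. square_integrable M U \<Longrightarrow> square_integrable M V \<Longrightarrow>
      \<bar>J (\<lambda>n. X n + U n) (\<lambda>n. Y n + V n) - J X Y - (L2_inner M G U + L2_inner M H V)\<bar>
        \<le> K * (L2_pair_norm M U V)\<^sup>2"
    and K: "0 < K"
  shows "has_L2_gradient M J X Y G H"
  unfolding has_L2_gradient_def
proof (intro conjI allI impI G H)
  fix e :: real
  assume e: "0 < e"
  show "\<exists>\<delta>>0. \<forall>U V. square_integrable M U \<longrightarrow> square_integrable M V \<longrightarrow> L2_pair_norm M U V < \<delta> \<longrightarrow>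
        \<bar>J (\<lambda>n. X n + U n) (\<lambda>n. Y n + V n) - J X Y - (L2_inner M G U + L2_inner M H V)\<bar>
          \<le> e * L2_pair_norm M U V"
  \<comment> \<open>Below the radius \<open>e / K\<close>, one factor of the quadratic bound
    \<open>K * (L2_pair_norm M U V)\<^sup>2\<close> is absorbed into \<open>e\<close>.\<close>
  proof (intro exI[of _ "e / K"] conjI allI impI)
    show "0 < e / K" using e K by simp
    fix U V :: "'a \<Rightarrow> real ^ 'b"
    assume U: "square_integrable M U" and V: "square_integrable M V"
      and small: "L2_pair_norm M U V < e / K"
    have "K * L2_pair_norm M U V \<le> e"
      using small K by (simp add: field_simps)
    then have "K * (L2_pair_norm M U V)\<^sup>2 \<le> e * L2_pair_norm M U V"
      using mult_right_mono[OF _ L2_pair_norm_nonneg[of M U V]] by (metis mult.assoc power2_eq_square)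
    with bound[OF U V]
    show "\<bar>J (\<lambda>n. X n + U n) (\<lambda>n. Y n + V n) - J X Y - (L2_inner M G U + L2_inner M H V)\<bar>
          \<le> e * L2_pair_norm M U V"
      by linarith
  qed
qed

text \<open>View invariance is assumed only on \<open>space M\<close>; this lemma rewrites gradients
  in terms of the common prediction there.\<close>

lemma has_L2_gradient_cong:
  assumes "\<And>n. n \<in> space M \<Longrightarrow> G n = G' n" and "\<And>n. n \<in> space M \<Longrightarrow> H n = H' n"
  shows "has_L2_gradient M J X Y G H \<longleftrightarrow> has_L2_gradient M J X Y G' H'"
proof -
  have "L2_inner M G U = L2_inner M G' U" "L2_inner M H U = L2_inner M H' U" for U
    unfolding L2_inner_def using assms by (auto intro!: Bochner_Integration.integral_cong)
  moreover have "square_integrable M G = square_integrable M G'"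
    "square_integrable M H = square_integrable M H'"
    using assms by (auto intro!: square_integrable_cong)
  ultimately show ?thesis
    by (simp add: has_L2_gradient_def)
qed

text \<open>A common translation cancels in the difference of the branches, and a common factor
  leaves the squared norm as its square.\<close>

lemma indep_consistency_affine:
  "indep_consistency M (\<lambda>n. c + t *\<^sub>R X n) (\<lambda>n. c + t *\<^sub>R Y n) = t\<^sup>2 * indep_consistency M X Y"
proof -
  have "norm (t *\<^sub>R x - t *\<^sub>R y) = \<bar>t\<bar> * norm (x - y)" for x y :: "real ^ 'b"
    by (simp flip: scaleR_diff_right)
  then show ?thesis
    by (simp add: indep_consistency_def power_mult_distrib case_prod_unfold)
qed

lemma shared_consistency_eq:
  assumes "square_integrable M X" "square_integrable M Y"
  shows "shared_consistency M X Y = L2_inner M X X + L2_inner M Y Y - 2 * L2_inner M X Y"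
  using assms square_integrable_inner[OF assms]
  by (simp add: shared_consistency_def L2_inner_self power2_norm_diff square_integrable_def)
    (simp add: L2_inner_def)

lemma has_L2_gradient_shared_consistency:
  assumes X: "square_integrable M X" and Y: "square_integrable M Y"
  shows "has_L2_gradient M (shared_consistency M) X Y
    (\<lambda>n. 2 *\<^sub>R (X n - Y n)) (\<lambda>n. 2 *\<^sub>R (Y n - X n))"
proof (rule has_L2_gradientI[where K = 2])
  fix U V :: "'a \<Rightarrow> real ^ 'b"
  assume U: "square_integrable M U" and V: "square_integrable M V"
  note sq = X Y U V
  have "shared_consistency M (\<lambda>n. X n + U n) (\<lambda>n. Y n + V n) - shared_consistency M X Y
      - (L2_inner M (\<lambda>n. 2 *\<^sub>R (X n - Y n)) U + L2_inner M (\<lambda>n. 2 *\<^sub>R (Y n - X n)) V)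
    = (L2_pair_norm M U V)\<^sup>2 - 2 * L2_inner M U V"
    using sq by (simp add: shared_consistency_eq L2_pair_norm_power2 L2_inner_scaleR_left
        L2_inner_add_left L2_inner_add_right L2_inner_diff_left square_integrable_add
        L2_inner_commute[of M U X] L2_inner_commute[of M V Y] L2_inner_commute[of M U Y])
  then show "\<bar>shared_consistency M (\<lambda>n. X n + U n) (\<lambda>n. Y n + V n) - shared_consistency M X Y
      - (L2_inner M (\<lambda>n. 2 *\<^sub>R (X n - Y n)) U + L2_inner M (\<lambda>n. 2 *\<^sub>R (Y n - X n)) V)\<bar>
      \<le> 2 * (L2_pair_norm M U V)\<^sup>2"
    using abs_L2_inner_le[OF U V] by linarith
qed (use X Y in \<open>auto intro: square_integrable_scaleR square_integrable_diff\<close>)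

section \<open>Means and covariances under a probability measure\<close>

context prob_space
begin

lemma square_integrable_const: "square_integrable M (\<lambda>n. c)"
  by (simp add: square_integrable_def)

lemma square_integrable_integrable:
  assumes X: "square_integrable M X"
  shows "integrable M X"
proof (rule Bochner_Integration.integrable_bound)
  \<comment> \<open>The majorant comes from expanding
    \<open>(norm (X n) - 1)\<^sup>2 \<ge> 0\<close>; its constant part is integrable because the
    measure is finite.\<close>
  show "integrable M (\<lambda>n. 1 + (norm (X n))\<^sup>2)"
    using X by (simp add: square_integrable_def)
  show "X \<in> borel_measurable M"
    using X by (simp add: square_integrable_def)
  show "AE n in M. norm (X n) \<le> norm (1 + (norm (X n))\<^sup>2)"
  proof (rule AE_I2)
    fix n
    have "norm (X n) \<le> 2 * norm (X n)"
      by simp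
    also have "\<dots> \<le> norm (1 + (norm (X n))\<^sup>2)"
      using zero_le_power2[of "norm (X n) - 1"] by (simp add: power2_diff)
    finally show "norm (X n) \<le> norm (1 + (norm (X n))\<^sup>2)" .
  qed
qed

lemma L2_inner_const_left: "integrable M Y \<Longrightarrow> L2_inner M (\<lambda>n. c) Y = c \<bullet> Expect M Y"
  by (simp add: L2_inner_def Expect_def)

lemma L2_inner_const_right: "integrable M X \<Longrightarrow> L2_inner M X (\<lambda>n. c) = Expect M X \<bullet> c"
  by (simp add: L2_inner_def Expect_def)

lemma Expect_add:
  "integrable M X \<Longrightarrow> integrable M Y \<Longrightarrow> Expect M (\<lambda>n. X n + Y n) = Expect M X + Expect M Y"
  by (simp add: Expect_def)

lemma Expect_const: "Expect M (\<lambda>n. c) = c"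
  by (simp add: Expect_def prob_space)

lemma centered_L2_inner:
  assumes X: "square_integrable M X" and Y: "square_integrable M Y"
  shows "L2_inner M (\<lambda>n. X n - Expect M X) (\<lambda>n. Y n - Expect M Y)
           = L2_inner M X Y - Expect M X \<bullet> Expect M Y"
  using X Y by (simp add: L2_inner_diff_left L2_inner_diff_right square_integrable_const
      square_integrable_diff square_integrable_integrable L2_inner_const_left L2_inner_const_right
      Expect_const)

lemma trace_Cov_centered:
  assumes X: "square_integrable M X" and Y: "square_integrable M Y"
  shows "trace (Cov M X Y) = L2_inner M (\<lambda>n. X n - Expect M X) (\<lambda>n. Y n - Expect M Y)"
proof -
  let ?X = "\<lambda>n. X n - Expect M X" and ?Y = "\<lambda>n. Y n - Expect M Y"
  have sq: "square_integrable M ?X" "square_integrable M ?Y"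
    using X Y by (auto intro: square_integrable_diff square_integrable_const)
  note square_integrable_component_mult[OF sq]
  then have "integrable M (\<lambda>n. (columnvector (?X n) :: real ^ 1 ^ 'b) ** transpose (columnvector (?Y n)))"
    unfolding outer_product_eq_sum by simp
  then have "trace (Cov M X Y)
      = (\<integral>n. trace ((columnvector (?X n) :: real ^ 1 ^ 'b) ** transpose (columnvector (?Y n))) \<partial>M)"
    unfolding Cov_def by (rule integral_bounded_linear[OF bounded_linear_trace, symmetric])
  then show ?thesis
    by (simp add: trace_outer_product L2_inner_def)
qed

lemma trace_Cov_eq:
  assumes "square_integrable M X" "square_integrable M Y"
  shows "trace (Cov M X Y) = L2_inner M X Y - Expect M X \<bullet> Expect M Y"
  using assms by (simp add: trace_Cov_centered centered_L2_inner)

text \<open>Jensen's inequality for the squared norm, read off from nonnegativity of the centered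
  second moment.\<close>

lemma norm_Expect_power2_le:
  assumes "square_integrable M X"
  shows "(norm (Expect M X))\<^sup>2 \<le> L2_inner M X X"
  using centered_L2_inner[OF assms assms] L2_inner_self_nonneg[of M "\<lambda>n. X n - Expect M X"]
  by (simp add: power2_norm_eq_inner)

text \<open>The trace is the integral of the squared distance to the mean. If it vanished,
  \<open>X\<close> would equal its mean almost everywhere.\<close>

lemma trace_Var_pos:
  assumes X: "square_integrable M X" and nc: "\<not> ae_constant M X"
  shows "0 < trace (Var M X)"
proof (rule ccontr)
  let ?f = "\<lambda>n. (norm (X n - Expect M X))\<^sup>2"
  assume "\<not> 0 < trace (Var M X)"
  moreover have tr: "trace (Var M X) = (\<integral>n. ?f n \<partial>M)"
    using X by (simp add: Var_def trace_Cov_centered L2_inner_self)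
  ultimately have "(\<integral>n. ?f n \<partial>M) = 0"
    by (smt (verit) integral_nonneg_AE AE_I2 zero_le_power2)
  moreover have "integrable M ?f"
    using square_integrable_diff[OF X square_integrable_const] by (simp add: square_integrable_def)
  ultimately have "AE n in M. X n = Expect M X"
    by (simp add: integral_nonneg_eq_0_iff_AE)
  with nc show False
    by (auto simp: ae_constant_def)
qed

section \<open>The independent-noise objective and its gradient\<close>

lemma indep_consistency_eq:
  assumes X: "square_integrable M X" and Y: "square_integrable M Y"
  shows "indep_consistency M X Y = L2_inner M X X + L2_inner M Y Y - 2 * (Expect M X \<bullet> Expect M Y)"
proof -
  interpret P: pair_prob_space M M ..
  have [measurable]: "X \<in> borel_measurable M" "Y \<in> borel_measurable M"
    using X Y by (auto simp: square_integrable_def)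
  have sqX: "integrable M (\<lambda>n. (norm (X n))\<^sup>2)" and sqY: "integrable M (\<lambda>n. (norm (Y n))\<^sup>2)"
    using X Y by (auto simp: square_integrable_def)
  note int = square_integrable_integrable[OF X] square_integrable_integrable[OF Y]
  \<comment> \<open>Joint integrability has to precede the iterated integral. The majorant is a sum
    of two terms, each depending on one draw only.\<close>
  have "integrable (M \<Otimes>\<^sub>M M) (\<lambda>z. (norm (X (fst z)))\<^sup>2)"
    by (rule P.Fubini_integrable) (use sqX in \<open>auto simp: prob_space\<close>)
  moreover have "integrable (M \<Otimes>\<^sub>M M) (\<lambda>z. (norm (Y (snd z)))\<^sup>2)"
    by (rule P.Fubini_integrable) (use sqY in auto)
  ultimately have sum: "integrable (M \<Otimes>\<^sub>M M)
      (\<lambda>z. 2 * ((norm (X (fst z)))\<^sup>2 + (norm (Y (snd z)))\<^sup>2))"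
    by simp
  have "integrable (M \<Otimes>\<^sub>M M) (\<lambda>(n, n'). (norm (X n - Y n'))\<^sup>2)"
  proof (rule Bochner_Integration.integrable_bound[OF sum])
    show "(\<lambda>(n, n'). (norm (X n - Y n'))\<^sup>2) \<in> borel_measurable (M \<Otimes>\<^sub>M M)"
      by measurable
    have "(norm (X n - Y n'))\<^sup>2 \<le> 2 * ((norm (X n))\<^sup>2 + (norm (Y n'))\<^sup>2)" for n n'
      by (rule power2_norm_diff_le)
    then show "AE z in M \<Otimes>\<^sub>M M. norm (case z of (n, n') \<Rightarrow> (norm (X n - Y n'))\<^sup>2)
        \<le> norm (2 * ((norm (X (fst z)))\<^sup>2 + (norm (Y (snd z)))\<^sup>2))"
      by (intro AE_I2) (auto simp: split_beta)
  qed
  then have "indep_consistency M X Y = (\<integral>n. (\<integral>n'. (norm (X n - Y n'))\<^sup>2 \<partial>M) \<partial>M)"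
    unfolding indep_consistency_def by (rule P.integral_fst[symmetric])
  \<comment> \<open>With \<open>n\<close> fixed, integrating over \<open>n'\<close> replaces
    \<open>Y n'\<close> in the cross term by its mean; integrating over \<open>n\<close> then does
    the same for \<open>X n\<close>.\<close>
  also have "\<dots> = (\<integral>n. (norm (X n))\<^sup>2 + L2_inner M Y Y - 2 * (X n \<bullet> Expect M Y) \<partial>M)"
    using sqY int by (simp add: power2_norm_diff L2_inner_self Expect_def prob_space)
  also have "\<dots> = L2_inner M X X + L2_inner M Y Y - 2 * (Expect M X \<bullet> Expect M Y)"
    using sqX int by (simp add: L2_inner_self Expect_def prob_space)
  finally show ?thesis .
qed

lemma has_L2_gradient_indep_consistency:
  assumes X: "square_integrable M X" and Y: "square_integrable M Y"
  shows "has_L2_gradient M (indep_consistency M) X Y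
    (\<lambda>n. 2 *\<^sub>R (X n - Expect M Y)) (\<lambda>n. 2 *\<^sub>R (Y n - Expect M X))"
proof (rule has_L2_gradientI[where K = 2])
  fix U V :: "'a \<Rightarrow> real ^ 'b"
  assume U: "square_integrable M U" and V: "square_integrable M V"
  note sq = X Y U V
  have "indep_consistency M (\<lambda>n. X n + U n) (\<lambda>n. Y n + V n) - indep_consistency M X Y
      - (L2_inner M (\<lambda>n. 2 *\<^sub>R (X n - Expect M Y)) U + L2_inner M (\<lambda>n. 2 *\<^sub>R (Y n - Expect M X)) V)
    = (L2_pair_norm M U V)\<^sup>2 - 2 * (Expect M U \<bullet> Expect M V)"
    using sq by (simp add: indep_consistency_eq L2_pair_norm_power2 L2_inner_scaleR_left
        L2_inner_add_left L2_inner_add_right L2_inner_diff_left square_integrable_add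
        square_integrable_const square_integrable_integrable L2_inner_const_left Expect_add
        L2_inner_commute[of M U X] L2_inner_commute[of M V Y] inner_add_left inner_add_right)
      (simp add: inner_commute)
  \<comment> \<open>Here the cross term of the remainder involves only the means of \<open>U\<close>
    and \<open>V\<close>, which Jensen's inequality bounds by the second moments.\<close>
  moreover have "\<bar>2 * (Expect M U \<bullet> Expect M V)\<bar> \<le> (L2_pair_norm M U V)\<^sup>2"
    using abs_two_inner_le[of "Expect M U" "Expect M V"] norm_Expect_power2_le[OF U]
      norm_Expect_power2_le[OF V] unfolding L2_pair_norm_power2 by linarith
  ultimately show "\<bar>indep_consistency M (\<lambda>n. X n + U n) (\<lambda>n. Y n + V n) - indep_consistency M X Y
      - (L2_inner M (\<lambda>n. 2 *\<^sub>R (X n - Expect M Y)) U + L2_inner M (\<lambda>n. 2 *\<^sub>R (Y n - Expect M X)) V)\<bar>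
      \<le> 2 * (L2_pair_norm M U V)\<^sup>2"
    by linarith
qed (intro square_integrable_scaleR square_integrable_diff square_integrable_const X Y zero_less_numeral)+

end

text \<open>The residual gradient is made precise in two ways: as the L2 gradient, which is twice
  the centered prediction where the shared-noise gradient is zero, and as the derivative along
  rescaling of the noise dependence. Strict positivity is claimed when \<open>D\<close> is not
  almost everywhere constant, since a constant has zero variance.\<close>

theorem proposition2:
  fixes M :: "'n measure" and D0 Dp :: "'n \<Rightarrow> real ^ 'd"
  assumes "prob_space M"
    and "square_integrable M D0"
    and "square_integrable M Dp"
  shows "indep_consistency M D0 Dp
           = shared_consistency M D0 Dp + 2 * trace (Cov M D0 Dp)
       \<and> (\<forall>D. (\<forall>n\<in>space M. D0 n = D n \<and> Dp n = D n) \<longrightarrow>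
            2 * trace (Cov M D0 Dp) = 2 * trace (Var M D)
          \<and> indep_consistency M D0 Dp = 2 * trace (Var M D)
          \<and> has_L2_gradient M (shared_consistency M) D0 Dp (\<lambda>n. 0) (\<lambda>n. 0)
          \<and> has_L2_gradient M (indep_consistency M) D0 Dp
              (\<lambda>n. 2 *\<^sub>R (D n - Expect M D)) (\<lambda>n. 2 *\<^sub>R (D n - Expect M D))
          \<and> ((\<lambda>t. indep_consistency M (scale_noise_dependence M D0 t) (scale_noise_dependence M Dp t))
               has_real_derivative 4 * trace (Var M D)) (at 1)
          \<and> (\<not> ae_constant M D \<longrightarrow>
               2 * trace (Var M D) > 0 \<and> indep_consistency M D0 Dp > 0))"
proof -
  interpret prob_space M by fact
  have indep: "indep_consistency M D0 Dp = shared_consistency M D0 Dp + 2 * trace (Cov M D0 Dp)"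
    using assms(2,3) by (simp add: indep_consistency_eq shared_consistency_eq trace_Cov_eq)
  show ?thesis
  proof (rule conjI[OF indep], intro allI impI, goal_cases)
    case (1 D)
    then have D0: "\<And>n. n \<in> space M \<Longrightarrow> D0 n = D n" and Dp: "\<And>n. n \<in> space M \<Longrightarrow> Dp n = D n"
      by auto
    have D: "square_integrable M D"
      using square_integrable_cong[of M D0 D] D0 assms(2) by simp
    have E: "Expect M D0 = Expect M D" "Expect M Dp = Expect M D"
      unfolding Expect_def using D0 Dp by (auto intro!: Bochner_Integration.integral_cong)
    have cov: "Cov M D0 Dp = Var M D"
      unfolding Var_def Cov_def E using D0 Dp
      by (intro Bochner_Integration.integral_cong) auto
    have "shared_consistency M D0 Dp = 0"
      unfolding shared_consistency_def using D0 Dp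
      by (subst Bochner_Integration.integral_cong[OF refl, of M _ "\<lambda>_. 0"]) auto
    with indep cov have val: "indep_consistency M D0 Dp = 2 * trace (Var M D)"
      by simp
    have shared_grad: "has_L2_gradient M (shared_consistency M) D0 Dp (\<lambda>n. 0) (\<lambda>n. 0)"
      using has_L2_gradient_shared_consistency[OF assms(2,3)]
      by (rule has_L2_gradient_cong[THEN iffD1, rotated 2]) (simp_all add: D0 Dp)
    have indep_grad: "has_L2_gradient M (indep_consistency M) D0 Dp
        (\<lambda>n. 2 *\<^sub>R (D n - Expect M D)) (\<lambda>n. 2 *\<^sub>R (D n - Expect M D))"
      using has_L2_gradient_indep_consistency[OF assms(2,3)]
      by (rule has_L2_gradient_cong[THEN iffD1, rotated 2]) (simp_all add: D0 Dp E)
    \<comment> \<open>Both branches have the same mean, so rescaling applies one affine map to both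
      and the objective is \<open>t\<^sup>2\<close> times its value at \<open>t = 1\<close>. The
      derivative at 1 is therefore twice that value.\<close>
    have "indep_consistency M (scale_noise_dependence M D0 t) (scale_noise_dependence M Dp t)
        = t\<^sup>2 * (2 * trace (Var M D))" for t
    proof -
      have "scale_noise_dependence M D0 t = (\<lambda>n. (1 - t) *\<^sub>R Expect M D + t *\<^sub>R D0 n)"
        "scale_noise_dependence M Dp t = (\<lambda>n. (1 - t) *\<^sub>R Expect M D + t *\<^sub>R Dp n)"
        by (auto simp: scale_noise_dependence_def E algebra_simps)
      then show ?thesis
        by (simp only: indep_consistency_affine val)
    qed
    then have deriv: "((\<lambda>t. indep_consistency M (scale_noise_dependence M D0 t)
        (scale_noise_dependence M Dp t)) has_real_derivative 4 * trace (Var M D)) (at 1)"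
      by (auto intro!: derivative_eq_intros)
    show ?case
      using trace_Var_pos[OF D] shared_grad indep_grad deriv by (simp add: cov val)
  qed
qed

end
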